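(* Let $R$ be a (commutative) Artin ring, let $\mathcal{A}$ be an associative $R$-algebra, and let $a \in \mathcal{A}$ be arbitrary. Then $a$ is co-integral over $R$ if and only if $a$ is integral over $R$.
   Context: $R$ is a commutative ring with unity and $\mathcal{A}$ is an associative, not necessarily commutative, $R$-algebra with unity (the structure map $R \to \mathcal{A}$ need not be injective). $R[a]$ denotes the $R$-subalgebra of $\mathcal{A}$ generated by $1$ and $a$. An element $a\in\mathcal{A}$ is integral over $R$ if $f(a)=0$ for some monic polynomial $f \in R[t]$. An element $a \in \mathcal{A}$ is called co-integral over $R$ if $a^N R[a] = a^{N+1} R[a]$ for some $N \in \mathbb{N} = \{0,1,2,\ldots\}$. *)

theory Defs
  imports "HOL-Algebra.UnivPoly" "HOL-Algebra.Subrings"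
begin

text \<open>The library's locale \<open>algebra\<close> requires the algebra itself to be commutative; here only the
  base ring is (through \<open>module\<close>). Neither ring is assumed to be nonzero.\<close>

locale assoc_algebra = module + ring M +
  assumes smult_mult_left:
      "\<lbrakk> r \<in> carrier R; x \<in> carrier M; y \<in> carrier M \<rbrakk> \<Longrightarrow>
      (r \<odot>\<^bsub>M\<^esub> x) \<otimes>\<^bsub>M\<^esub> y = r \<odot>\<^bsub>M\<^esub> (x \<otimes>\<^bsub>M\<^esub> y)"
    and smult_mult_right:
      "\<lbrakk> r \<in> carrier R; x \<in> carrier M; y \<in> carrier M \<rbrakk> \<Longrightarrow>
      x \<otimes>\<^bsub>M\<^esub> (r \<odot>\<^bsub>M\<^esub> y) = r \<odot>\<^bsub>M\<^esub> (x \<otimes>\<^bsub>M\<^esub> y)"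

locale artinian_cring = cring +
  assumes descending_chain_condition:
    "\<lbrakk> \<And>n::nat. ideal (I n) R; \<And>n. I (Suc n) \<subseteq> I n \<rbrakk> \<Longrightarrow> \<exists>N. \<forall>n\<ge>N. I n = I N"

definition structure_map :: "('r, 'm) ring_scheme \<Rightarrow> ('r, 'a, 'n) module_scheme \<Rightarrow> 'r \<Rightarrow> 'a"
  where "structure_map R A r = r \<odot>\<^bsub>A\<^esub> \<one>\<^bsub>A\<^esub>"

definition is_subalgebra :: "'a set \<Rightarrow> ('r, 'm) ring_scheme \<Rightarrow> ('r, 'a, 'n) module_scheme \<Rightarrow> bool"
  where "is_subalgebra B R A \<longleftrightarrow>
    subring B A \<and> (\<forall>r\<in>carrier R. \<forall>x\<in>B. r \<odot>\<^bsub>A\<^esub> x \<in> B)"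

text \<open>The subalgebra \<open>R[a]\<close> generated by \<open>1\<close> and \<open>a\<close>; note that \<open>subring\<close> includes \<open>1 \<in> B\<close>.\<close>

definition adjoin :: "('r, 'm) ring_scheme \<Rightarrow> ('r, 'a, 'n) module_scheme \<Rightarrow> 'a \<Rightarrow> 'a set"
  where "adjoin R A a = \<Inter> {B. is_subalgebra B R A \<and> a \<in> B}"

definition monic :: "('r, 'm) ring_scheme \<Rightarrow> (nat \<Rightarrow> 'r) \<Rightarrow> bool"
  where "monic R f \<longleftrightarrow> f \<in> carrier (UP R) \<and> coeff (UP R) f (deg R f) = \<one>\<^bsub>R\<^esub>"

definition integral_over :: "('r, 'm) ring_scheme \<Rightarrow> ('r, 'a, 'n) module_scheme \<Rightarrow> 'a \<Rightarrow> bool"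
  where "integral_over R A a \<longleftrightarrow> (\<exists>f. monic R f \<and> eval R A (structure_map R A) a f = \<zero>\<^bsub>A\<^esub>)"

definition cointegral_over :: "('r, 'm) ring_scheme \<Rightarrow> ('r, 'a, 'n) module_scheme \<Rightarrow> 'a \<Rightarrow> bool"
  where "cointegral_over R A a \<longleftrightarrow>
    (\<exists>N::nat. (a [^]\<^bsub>A\<^esub> N) <#\<^bsub>A\<^esub> adjoin R A a = (a [^]\<^bsub>A\<^esub> (N + 1)) <#\<^bsub>A\<^esub> adjoin R A a)"

end

theory Submission
  imports Defs
begin

text \<open>
  Both conditions on \<open>a\<close> say that some power of \<open>a\<close> is an \<open>R\<close>-linear combination of other powers:
  of smaller ones if \<open>a\<close> is integral (\<open>integral_iff\<close>), of larger ones if \<open>a\<close> is co-integral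
  (\<open>cointegral_iff\<close>). So each amounts to a relation \<open>\<Sum>i. c i \<odot> a ^ i = 0\<close> in which one
  coefficient is \<open>1\<close>, with that coefficient in the highest or in the lowest position. Over an Artin
  ring the position is immaterial: any relation with a coefficient \<open>1\<close> yields one where the \<open>1\<close> is
  extremal (\<open>power_among_lower_terms\<close>). Applied to the two orderings of the exponents, this gives the
  two implications of the equivalence.

  To move the \<open>1\<close> to the extremal position, fix a direction and call the terms on one side of \<open>a ^ m\<close>
  lower than \<open>a ^ m\<close>. Let \<open>T\<close> be the set of all \<open>u\<close> in \<open>R\<close> such that \<open>u \<odot> a ^ m\<close> plus a
  combination of lower terms is nilpotent for some \<open>m\<close>. Multiplication by powers of \<open>a\<close> aligns two
  such expressions, and sums of commuting nilpotents are nilpotent, so \<open>T\<close> is an ideal. The key fact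
  is that every coefficient of a nilpotent combination \<open>\<Sum>i. c i \<odot> a ^ i\<close> belongs to \<open>T\<close>
  (\<open>coeffs_of_nilpotent_are_leading\<close>). Its leading coefficient \<open>c\<close> does by definition. The descending
  chain of the ideals \<open>c ^ n R\<close> becomes stationary, which provides an \<open>s\<close> for which \<open>(1 - c s) c\<close> is
  nilpotent (\<open>regular_modulo_nilpotents\<close>). Multiplied by \<open>1 - c s\<close>, the combination stays
  nilpotent and its leading term becomes nilpotent, hence may be dropped. By induction on the number
  of terms, \<open>(1 - c s) d\<close> lies in \<open>T\<close> for every other coefficient \<open>d\<close>, and then so does
  \<open>d = (1 - c s) d + c s d\<close>.

  A relation with a coefficient \<open>1\<close> therefore puts \<open>1\<close> into \<open>T\<close>: some \<open>a ^ m + x\<close> is nilpotent,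
  where \<open>x\<close> is a combination of lower terms. Expanding \<open>(a ^ m + x) ^ k = 0\<close> expresses \<open>a ^ (m k)\<close>
  by terms lower than it.
\<close>

section \<open>Nilpotent elements\<close>

definition nilpotent :: "('a, 'm) ring_scheme \<Rightarrow> 'a \<Rightarrow> bool"
  where "nilpotent A x \<longleftrightarrow> x \<in> carrier A \<and> (\<exists>k::nat. x [^]\<^bsub>A\<^esub> k = \<zero>\<^bsub>A\<^esub>)"

context ring
begin

text \<open>In place of the binomial theorem: every term of the expansion except \<open>x [^] n\<close> contains a
  factor \<open>y\<close>. That the cofactor \<open>z\<close> commutes with \<open>y\<close> is what lets powers of \<open>y \<otimes> z\<close> be split.\<close>

lemma add_pow_commuting:
  assumes [simp]: "x \<in> carrier R" "y \<in> carrier R" and comm: "x \<otimes> y = y \<otimes> x"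
  shows "\<exists>z \<in> carrier R. z \<otimes> y = y \<otimes> z \<and> (x \<oplus> y) [^] (n::nat) = x [^] n \<oplus> y \<otimes> z"
proof (induction n)
  case 0
  show ?case by (rule bexI[of _ \<zero>]) auto
next
  case (Suc n)
  then obtain z where [simp]: "z \<in> carrier R" and zy: "z \<otimes> y = y \<otimes> z"
    and eq: "(x \<oplus> y) [^] n = x [^] n \<oplus> y \<otimes> z" by blast
  define w where "w = x [^] n \<oplus> z \<otimes> x \<oplus> z \<otimes> y"
  have xny: "x [^] n \<otimes> y = y \<otimes> x [^] n"
    by (rule group_commutes_pow) (simp_all add: comm)
  have zxy: "z \<otimes> x \<otimes> y = y \<otimes> (z \<otimes> x)"
    by (metis assms(1,2) comm zy m_assoc \<open>z \<in> carrier R\<close>)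
  have "w \<otimes> y = y \<otimes> w"
    by (simp add: w_def l_distr r_distr xny zxy) (metis \<open>z \<in> carrier R\<close> assms(2) m_assoc zy)
  moreover have "(x \<oplus> y) [^] Suc n = x [^] Suc n \<oplus> y \<otimes> w"
    by (simp add: eq w_def l_distr r_distr xny a_ac m_assoc)
  moreover have "w \<in> carrier R" by (simp add: w_def)
  ultimately show ?case by blast
qed

text \<open>If \<open>x [^] p = \<zero>\<close>, then \<open>(x \<oplus> y) [^] p\<close> is a multiple of \<open>y\<close> by a commuting factor, and so
  nilpotent along with \<open>y\<close>.\<close>

lemma nilpotent_add:
  assumes "nilpotent R x" "nilpotent R y" and comm: "x \<otimes> y = y \<otimes> x"
  shows "nilpotent R (x \<oplus> y)"
proof -
  from assms obtain p q :: nat where [simp]: "x \<in> carrier R" "y \<in> carrier R"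
    and p: "x [^] p = \<zero>" and q: "y [^] q = \<zero>"
    by (auto simp: nilpotent_def)
  obtain z where [simp]: "z \<in> carrier R" and zy: "z \<otimes> y = y \<otimes> z"
    and eq: "(x \<oplus> y) [^] p = x [^] p \<oplus> y \<otimes> z"
    using add_pow_commuting[OF _ _ comm, of p] by auto
  have "(x \<oplus> y) [^] (p * q) = ((x \<oplus> y) [^] p) [^] q" by (simp add: nat_pow_pow)
  also have "\<dots> = y [^] q \<otimes> z [^] q" by (simp add: eq p pow_mult_distrib zy)
  also have "\<dots> = \<zero>" by (simp add: q)
  finally show ?thesis by (auto simp: nilpotent_def)
qed

lemma nilpotent_mult:
  assumes "nilpotent R x" "y \<in> carrier R" and comm: "x \<otimes> y = y \<otimes> x"
  shows "nilpotent R (x \<otimes> y)"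
proof -
  from assms obtain p :: nat where [simp]: "x \<in> carrier R" "y \<in> carrier R" and p: "x [^] p = \<zero>"
    by (auto simp: nilpotent_def)
  have "(x \<otimes> y) [^] p = \<zero>" by (simp add: pow_mult_distrib comm p)
  then show ?thesis by (auto simp: nilpotent_def)
qed

end

text \<open>This is the only use of the descending chain condition: an Artin ring is von Neumann regular
  modulo its nilradical. Stationarity of the ideals generated by the powers of \<open>r\<close> gives
  \<open>r [^] n = s \<otimes> r [^] (n + 1)\<close>, that is, \<open>\<one> \<ominus> r \<otimes> s\<close> annihilates \<open>r [^] n\<close>.\<close>

lemma (in artinian_cring) regular_modulo_nilpotents:
  assumes [simp]: "r \<in> carrier R"
  shows "\<exists>s \<in> carrier R. nilpotent R ((\<one> \<ominus> r \<otimes> s) \<otimes> r)"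
proof -
  have chain: "PIdl (r [^] Suc n) \<subseteq> PIdl (r [^] n)" for n :: nat
  proof
    fix x assume "x \<in> PIdl (r [^] Suc n)"
    then obtain y where [simp]: "y \<in> carrier R" and "x = y \<otimes> (r [^] n \<otimes> r)"
      by (auto simp: cgenideal_def)
    then have "x = (y \<otimes> r) \<otimes> r [^] n"
      using m_assoc[of y r "r [^] n"] m_comm[of r "r [^] n"] by simp
    then show "x \<in> PIdl (r [^] n)" 
      unfolding cgenideal_def by (intro CollectI exI[of _ "y \<otimes> r"]) simp
  qed
  have "\<exists>n. \<forall>m\<ge>n. PIdl (r [^] m) = PIdl (r [^] (n::nat))"
    by (rule descending_chain_condition) (simp_all only: cgenideal_ideal nat_pow_closed assms chain)
  then obtain n :: nat where "\<forall>m\<ge>n. PIdl (r [^] m) = PIdl (r [^] n)" by blast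
  then have "r [^] n \<in> PIdl (r [^] Suc n)"
    using cgenideal_self[of "r [^] n"] by (metis assms le_SucI nat_pow_closed order_refl)
  then obtain s where [simp]: "s \<in> carrier R" and s: "r [^] n = s \<otimes> (r [^] n \<otimes> r)"
    by (auto simp: cgenideal_def)
  define w where "w = \<one> \<ominus> r \<otimes> s"
  have [simp]: "w \<in> carrier R" by (simp add: w_def)
  have "w \<otimes> r [^] n = r [^] n \<ominus> s \<otimes> (r [^] n \<otimes> r)"
    by (simp add: w_def minus_eq l_distr l_minus) (simp add: m_ac)
  also have "\<dots> = \<zero>" by (simp flip: s)
  finally have "w \<otimes> r [^] n = \<zero>" .
  \<comment> \<open>The exponent is \<open>Suc n\<close> so that a factor \<open>w\<close> is available even when \<open>n = 0\<close>.\<close>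
  have "(w \<otimes> r) [^] Suc n = (w [^] n \<otimes> r) \<otimes> (w \<otimes> r [^] n)"
    by (simp add: nat_pow_distrib m_ac)
  also have "\<dots> = \<zero>" by (simp add: \<open>w \<otimes> r [^] n = \<zero>\<close>)
  finally show ?thesis
    by (intro bexI[of _ s]) (auto simp: nilpotent_def w_def intro: exI[of _ "Suc n"])
qed

section \<open>Linear combinations of powers of an element\<close>

locale algebra_element = R: cring R + A: ring A + assoc_algebra R A
  for R :: "('r, 'm) ring_scheme" (structure) and A :: "('r, 'a, 'n) module_scheme" (structure) +
  fixes a
  assumes elem_closed [simp]: "a \<in> carrier A"
begin

lemma nilpotent_smult:
  assumes [simp]: "r \<in> carrier R" "x \<in> carrier A" and "nilpotent R r \<or> nilpotent A x"
  shows "nilpotent A (r \<odot>\<^bsub>A\<^esub> x)"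
proof -
  have pow: "(r \<odot>\<^bsub>A\<^esub> x) [^]\<^bsub>A\<^esub> k = (r [^] k) \<odot>\<^bsub>A\<^esub> (x [^]\<^bsub>A\<^esub> k)" for k :: nat
    by (induction k) (simp_all add: smult_mult_left smult_mult_right R.m_comm flip: smult_assoc1)
  show ?thesis
    using assms(3) by (auto simp: nilpotent_def pow) (metis smult_l_null smult_r_null assms(1,2) A.nat_pow_closed R.nat_pow_closed)+
qed

text \<open>The \<open>R\<close>-submodule of \<open>A\<close> spanned by the powers of \<open>a\<close> with exponent in \<open>S\<close>. Keeping track of
  exponents by a set lets one family of closure lemmas serve the polynomial expressions in \<open>a\<close>
  below a degree, those above an order, and the whole of \<open>R[a]\<close>.\<close>

inductive_set power_span :: "nat set \<Rightarrow> 'a set" for S where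
  zero: "\<zero>\<^bsub>A\<^esub> \<in> power_span S"
| add_term: "r \<in> carrier R \<Longrightarrow> i \<in> S \<Longrightarrow> x \<in> power_span S \<Longrightarrow>
    r \<odot>\<^bsub>A\<^esub> (a [^]\<^bsub>A\<^esub> i) \<oplus>\<^bsub>A\<^esub> x \<in> power_span S"

lemma power_span_closed [simp]: "x \<in> power_span S \<Longrightarrow> x \<in> carrier A"
  by (induction rule: power_span.induct) auto

lemma power_span_add:
  "x \<in> power_span S \<Longrightarrow> y \<in> power_span S \<Longrightarrow> x \<oplus>\<^bsub>A\<^esub> y \<in> power_span S"
  by (induction rule: power_span.induct) (auto simp: A.a_assoc intro: power_span.intros)

lemma power_span_term: "r \<in> carrier R \<Longrightarrow> i \<in> S \<Longrightarrow> r \<odot>\<^bsub>A\<^esub> (a [^]\<^bsub>A\<^esub> i) \<in> power_span S"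
  using power_span.add_term[of r i S "\<zero>\<^bsub>A\<^esub>"] by (simp add: power_span.zero)

lemma power_span_power: "i \<in> S \<Longrightarrow> a [^]\<^bsub>A\<^esub> i \<in> power_span S"
  using power_span_term[of \<one> i S] by simp

lemma power_span_mono: "x \<in> power_span S \<Longrightarrow> S \<subseteq> T \<Longrightarrow> x \<in> power_span T"
  by (induction rule: power_span.induct) (auto intro: power_span.intros)

lemma power_span_smult: "x \<in> power_span S \<Longrightarrow> r \<in> carrier R \<Longrightarrow> r \<odot>\<^bsub>A\<^esub> x \<in> power_span S"
  by (induction rule: power_span.induct)
    (auto simp: smult_r_distr smult_assoc1[symmetric] intro: power_span.intros)

lemma power_span_uminus: "x \<in> power_span S \<Longrightarrow> \<ominus>\<^bsub>A\<^esub> x \<in> power_span S"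
  using power_span_smult[of x S "\<ominus> \<one>"] by (simp add: smult_l_minus)

lemma power_span_mult:
  assumes "x \<in> power_span S" "y \<in> power_span T" and ST: "\<And>i j. i \<in> S \<Longrightarrow> j \<in> T \<Longrightarrow> i + j \<in> V"
  shows "x \<otimes>\<^bsub>A\<^esub> y \<in> power_span V"
  using assms(1)
proof (induction rule: power_span.induct)
  case zero
  with assms show ?case by (simp add: power_span.zero)
next
  case (add_term r i x)
  have "a [^]\<^bsub>A\<^esub> i \<otimes>\<^bsub>A\<^esub> y \<in> power_span V"
    using assms(2)
  proof (induction rule: power_span.induct)
    case zero
    show ?case by (simp add: power_span.zero)
  next
    case (add_term s j y)
    then show ?case using ST[OF \<open>i \<in> S\<close>]
      by (simp add: A.r_distr smult_mult_right A.nat_pow_mult power_span.intros)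
  qed
  then have "r \<odot>\<^bsub>A\<^esub> (a [^]\<^bsub>A\<^esub> i \<otimes>\<^bsub>A\<^esub> y) \<in> power_span V" by (simp add: add_term power_span_smult)
  with add_term assms(2) show ?case
    by (simp add: A.l_distr smult_mult_left power_span_add)
qed

lemma power_span_commute:
  assumes "x \<in> power_span S" "y \<in> power_span T"
  shows "x \<otimes>\<^bsub>A\<^esub> y = y \<otimes>\<^bsub>A\<^esub> x"
  using assms(1)
proof (induction rule: power_span.induct)
  case zero
  with assms show ?case by simp
next
  case (add_term r i x)
  have "a [^]\<^bsub>A\<^esub> i \<otimes>\<^bsub>A\<^esub> y = y \<otimes>\<^bsub>A\<^esub> a [^]\<^bsub>A\<^esub> i"
    using assms(2)
    by (induction rule: power_span.induct)
      (auto simp: A.l_distr A.r_distr smult_mult_left smult_mult_right A.nat_pow_mult add.commute)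
  with add_term assms(2) show ?case
    by (simp add: A.l_distr A.r_distr smult_mult_left smult_mult_right)
qed

lemma finsum_in_power_span:
  assumes "finite F" "F \<subseteq> S" "c \<in> F \<rightarrow> carrier R"
  shows "(\<Oplus>\<^bsub>A\<^esub>i\<in>F. c i \<odot>\<^bsub>A\<^esub> (a [^]\<^bsub>A\<^esub> i)) \<in> power_span S"
  using assms
proof (induction rule: finite_induct)
  case empty
  show ?case by (simp add: power_span.zero)
next
  case (insert i F)
  then show ?case
    by (subst A.finsum_insert) (auto intro!: power_span.intros)
qed

text \<open>The index set stays finite and each exponent occurs in it once, so that single coefficients of
  the combination can be spoken of. The coefficient function is total to spare side conditions when
  the index set changes.\<close>

lemma power_span_imp_finsum:
  assumes "x \<in> power_span S"
  shows "\<exists>F c. finite F \<and> F \<subseteq> S \<and> c \<in> UNIV \<rightarrow> carrier R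
    \<and> x = (\<Oplus>\<^bsub>A\<^esub>i\<in>F. c i \<odot>\<^bsub>A\<^esub> (a [^]\<^bsub>A\<^esub> i))"
  using assms
proof (induction rule: power_span.induct)
  case zero
  show ?case by (rule exI[of _ "{}"], rule exI[of _ "\<lambda>_. \<zero>"]) auto
next
  case (add_term r i x)
  then obtain F c where F: "finite F" "F \<subseteq> S" and c: "c \<in> UNIV \<rightarrow> carrier R"
    and x: "x = (\<Oplus>\<^bsub>A\<^esub>i\<in>F. c i \<odot>\<^bsub>A\<^esub> (a [^]\<^bsub>A\<^esub> i))" by blast
  have cc [simp]: "c j \<in> carrier R" for j using c by auto
  define G where "G = F - {i}"
  \<comment> \<open>The exponent \<open>i\<close> may occur already; then the new term is absorbed into its coefficient.\<close>
  define d where "d = c(i := if i \<in> F then r \<oplus> c i else r)"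
  have rest: "(\<Oplus>\<^bsub>A\<^esub>j\<in>G. d j \<odot>\<^bsub>A\<^esub> (a [^]\<^bsub>A\<^esub> j)) = (\<Oplus>\<^bsub>A\<^esub>j\<in>G. c j \<odot>\<^bsub>A\<^esub> (a [^]\<^bsub>A\<^esub> j))"
    by (rule A.finsum_cong') (auto simp: G_def d_def)
  have G: "finite G" "i \<notin> G" using F by (auto simp: G_def)
  have d: "d j \<in> carrier R" for j using add_term by (simp add: d_def)
  have "(\<Oplus>\<^bsub>A\<^esub>j\<in>insert i G. d j \<odot>\<^bsub>A\<^esub> (a [^]\<^bsub>A\<^esub> j))
      = d i \<odot>\<^bsub>A\<^esub> (a [^]\<^bsub>A\<^esub> i) \<oplus>\<^bsub>A\<^esub> (\<Oplus>\<^bsub>A\<^esub>j\<in>G. c j \<odot>\<^bsub>A\<^esub> (a [^]\<^bsub>A\<^esub> j))"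
    by (simp add: A.finsum_insert G d Pi_def rest)
  also have "\<dots> = r \<odot>\<^bsub>A\<^esub> (a [^]\<^bsub>A\<^esub> i) \<oplus>\<^bsub>A\<^esub> x"
  proof (cases "i \<in> F")
    case True
    then have "F = insert i G" by (auto simp: G_def)
    then have "x = c i \<odot>\<^bsub>A\<^esub> (a [^]\<^bsub>A\<^esub> i) \<oplus>\<^bsub>A\<^esub> (\<Oplus>\<^bsub>A\<^esub>j\<in>G. c j \<odot>\<^bsub>A\<^esub> (a [^]\<^bsub>A\<^esub> j))"
      using G by (simp only: x) (simp add: A.finsum_insert Pi_def)
    then show ?thesis using True add_term
      by (simp add: d_def smult_l_distr A.a_assoc)
  next
    case False
    then show ?thesis by (simp add: d_def x G_def)
  qed
  finally show ?case using F add_term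
    by (intro exI[of _ "insert i G"] exI[of _ d]) (auto simp: G_def d_def)
qed

end

section \<open>Leading coefficients up to nilpotents\<close>

text \<open>A relation \<open>i \<prec> m\<close> on exponents means that \<open>a ^ i\<close> counts as lower than \<open>a ^ m\<close>. Both \<open><\<close>
  and \<open>>\<close> satisfy the assumptions; the leading term is then the one of highest or lowest degree,
  respectively.\<close>

locale leading_terms = algebra_element R A a + artinian_cring R
  for R :: "('r, 'm) ring_scheme" (structure) and A :: "('r, 'a, 'n) module_scheme" (structure)
    and a +
  fixes prec :: "nat \<Rightarrow> nat \<Rightarrow> bool" (infix "\<prec>" 50)
  assumes prec_trans: "i \<prec> j \<Longrightarrow> j \<prec> k \<Longrightarrow> i \<prec> k"
    and prec_total: "i \<noteq> j \<Longrightarrow> i \<prec> j \<or> j \<prec> i"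
    and prec_add_right: "i \<prec> j \<Longrightarrow> i + k \<prec> j + k"
begin

lemma prec_add: "i \<prec> m \<Longrightarrow> j \<prec> n \<Longrightarrow> i + j \<prec> m + n"
  using prec_trans[OF prec_add_right[of i m j]] prec_add_right[of j n m] by (simp add: add.commute)

lemma ex_leading_index:
  assumes "finite S" "S \<noteq> {}"
  shows "\<exists>m\<in>S. \<forall>i\<in>S - {m}. i \<prec> m"
  using assms
proof (induction rule: finite_ne_induct)
  case (insert x F)
  then obtain m where m: "m \<in> F" "\<forall>i\<in>F - {m}. i \<prec> m" by blast
  then consider "x \<prec> m" | "m \<prec> x" using prec_total insert by metis
  then show ?case
    using m prec_trans by cases blast+
qed simp

abbreviation lower_terms :: "nat \<Rightarrow> 'a set"
  where "lower_terms m \<equiv> power_span {i. i \<prec> m}"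

text \<open>The ideal \<open>T\<close> of the introduction. Asking for nilpotent expressions, where an ideal of leading
  coefficients would usually ask for vanishing ones, is what allows a term with nilpotent
  coefficient to be dropped.\<close>

definition leading_coeffs :: "'r set"
  where "leading_coeffs = {u \<in> carrier R.
    \<exists>m. \<exists>x \<in> lower_terms m. nilpotent A (u \<odot>\<^bsub>A\<^esub> (a [^]\<^bsub>A\<^esub> m) \<oplus>\<^bsub>A\<^esub> x)}"

lemma leading_form_in_span:
  assumes "u \<in> carrier R" "x \<in> power_span S"
  shows "u \<odot>\<^bsub>A\<^esub> (a [^]\<^bsub>A\<^esub> (m::nat)) \<oplus>\<^bsub>A\<^esub> x \<in> power_span UNIV"
  by (rule power_span.add_term[OF assms(1) UNIV_I power_span_mono[OF assms(2) subset_UNIV]])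

text \<open>Multiplication by \<open>a ^ k\<close> raises the leading exponent in either direction of \<open>\<prec>\<close>, because
  \<open>\<prec>\<close> is invariant under translation. This brings two leading exponents to a common value.\<close>

lemma leading_form_shift:
  assumes [simp]: "u \<in> carrier R" and x: "x \<in> lower_terms m"
    and nil: "nilpotent A (u \<odot>\<^bsub>A\<^esub> (a [^]\<^bsub>A\<^esub> m) \<oplus>\<^bsub>A\<^esub> x)"
  shows "\<exists>y \<in> lower_terms (m + k). nilpotent A (u \<odot>\<^bsub>A\<^esub> (a [^]\<^bsub>A\<^esub> (m + k)) \<oplus>\<^bsub>A\<^esub> y)"
proof
  have k: "a [^]\<^bsub>A\<^esub> k \<in> power_span {k}" by (simp add: power_span_power)
  show "x \<otimes>\<^bsub>A\<^esub> a [^]\<^bsub>A\<^esub> k \<in> lower_terms (m + k)"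
    by (rule power_span_mult[OF x k]) (auto intro: prec_add_right)
  have "nilpotent A ((u \<odot>\<^bsub>A\<^esub> (a [^]\<^bsub>A\<^esub> m) \<oplus>\<^bsub>A\<^esub> x) \<otimes>\<^bsub>A\<^esub> a [^]\<^bsub>A\<^esub> k)"
    by (rule A.nilpotent_mult[OF nil _ power_span_commute[OF leading_form_in_span k]]) (use x in auto)
  then show "nilpotent A (u \<odot>\<^bsub>A\<^esub> (a [^]\<^bsub>A\<^esub> (m + k)) \<oplus>\<^bsub>A\<^esub> (x \<otimes>\<^bsub>A\<^esub> a [^]\<^bsub>A\<^esub> k))"
    using x by (simp add: A.l_distr smult_mult_left A.nat_pow_mult)
qed

lemma leading_coeffs_add:
  assumes "u \<in> leading_coeffs" "v \<in> leading_coeffs"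
  shows "u \<oplus> v \<in> leading_coeffs"
proof -
  from assms obtain m n x y where [simp]: "u \<in> carrier R" "v \<in> carrier R"
    and x: "x \<in> lower_terms m" "nilpotent A (u \<odot>\<^bsub>A\<^esub> (a [^]\<^bsub>A\<^esub> m) \<oplus>\<^bsub>A\<^esub> x)"
    and y: "y \<in> lower_terms n" "nilpotent A (v \<odot>\<^bsub>A\<^esub> (a [^]\<^bsub>A\<^esub> n) \<oplus>\<^bsub>A\<^esub> y)"
    by (auto simp: leading_coeffs_def)
  obtain x' where x': "x' \<in> lower_terms (m + n)"
      "nilpotent A (u \<odot>\<^bsub>A\<^esub> (a [^]\<^bsub>A\<^esub> (m + n)) \<oplus>\<^bsub>A\<^esub> x')"
    using leading_form_shift[OF _ x, of n] by auto
  obtain y' where y': "y' \<in> lower_terms (m + n)"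
      "nilpotent A (v \<odot>\<^bsub>A\<^esub> (a [^]\<^bsub>A\<^esub> (m + n)) \<oplus>\<^bsub>A\<^esub> y')"
    using leading_form_shift[OF _ y, of m] by (auto simp: add.commute)
  have "nilpotent A ((u \<odot>\<^bsub>A\<^esub> (a [^]\<^bsub>A\<^esub> (m + n)) \<oplus>\<^bsub>A\<^esub> x') \<oplus>\<^bsub>A\<^esub>
      (v \<odot>\<^bsub>A\<^esub> (a [^]\<^bsub>A\<^esub> (m + n)) \<oplus>\<^bsub>A\<^esub> y'))"
    by (rule A.nilpotent_add[OF x'(2) y'(2)])
      (rule power_span_commute[OF leading_form_in_span leading_form_in_span], use x' y' in auto)
  then have "nilpotent A ((u \<oplus> v) \<odot>\<^bsub>A\<^esub> (a [^]\<^bsub>A\<^esub> (m + n)) \<oplus>\<^bsub>A\<^esub> (x' \<oplus>\<^bsub>A\<^esub> y'))"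
    using x' y' by (simp add: smult_l_distr A.a_ac)
  then show ?thesis
    using power_span_add[OF x'(1) y'(1)] by (auto simp: leading_coeffs_def)
qed

lemma leading_coeffs_mult:
  assumes "u \<in> leading_coeffs" and [simp]: "r \<in> carrier R"
  shows "r \<otimes> u \<in> leading_coeffs"
proof -
  from assms obtain m x where [simp]: "u \<in> carrier R"
    and x: "x \<in> lower_terms m" "nilpotent A (u \<odot>\<^bsub>A\<^esub> (a [^]\<^bsub>A\<^esub> m) \<oplus>\<^bsub>A\<^esub> x)"
    by (auto simp: leading_coeffs_def)
  have "nilpotent A (r \<odot>\<^bsub>A\<^esub> (u \<odot>\<^bsub>A\<^esub> (a [^]\<^bsub>A\<^esub> m) \<oplus>\<^bsub>A\<^esub> x))"
    using x by (intro nilpotent_smult) auto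
  then have "nilpotent A ((r \<otimes> u) \<odot>\<^bsub>A\<^esub> (a [^]\<^bsub>A\<^esub> m) \<oplus>\<^bsub>A\<^esub> r \<odot>\<^bsub>A\<^esub> x)"
    using x by (simp add: smult_r_distr smult_assoc1)
  then show ?thesis
    using power_span_smult[OF x(1), of r] by (auto simp: leading_coeffs_def)
qed

text \<open>By induction on the number of terms: multiplication by \<open>w = \<one> \<ominus> c m \<otimes> s\<close> makes the leading term
  nilpotent, so the remaining terms form a shorter nilpotent combination. Its coefficients are only
  the multiples \<open>w \<otimes> c i\<close>, but \<open>w\<close> is \<open>\<one>\<close> modulo \<open>c m\<close>, which is a leading coefficient itself.\<close>

lemma coeffs_of_nilpotent_are_leading:
  assumes "finite (S::nat set)" "c \<in> UNIV \<rightarrow> carrier R"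
    and "nilpotent A (\<Oplus>\<^bsub>A\<^esub>i\<in>S. c i \<odot>\<^bsub>A\<^esub> (a [^]\<^bsub>A\<^esub> i))" and "j \<in> S"
  shows "c j \<in> leading_coeffs"
  using assms
proof (induction arbitrary: c j rule: finite_psubset_induct)
  case (psubset S)
  have cc [simp]: "c i \<in> carrier R" for i using psubset.prems by auto
  obtain m where m: "m \<in> S" "\<forall>i\<in>S - {m}. i \<prec> m"
    using ex_leading_index[of S] psubset.hyps psubset.prems(3) by fast
  define T where "T = S - {m}"
  have T: "finite T" "m \<notin> T" "S = insert m T" "T \<subset> S" "T \<subseteq> {i. i \<prec> m}"
    using m psubset.hyps by (auto simp: T_def)
  let ?sum = "\<lambda>c. \<Oplus>\<^bsub>A\<^esub>i\<in>T. c i \<odot>\<^bsub>A\<^esub> (a [^]\<^bsub>A\<^esub> i)"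
  have nil: "nilpotent A (c m \<odot>\<^bsub>A\<^esub> (a [^]\<^bsub>A\<^esub> m) \<oplus>\<^bsub>A\<^esub> ?sum c)"
    using psubset.prems(2) T by (simp add: A.finsum_insert Pi_def)
  have sum: "?sum c \<in> lower_terms m" "?sum c \<in> power_span UNIV"
    by (rule finsum_in_power_span; use T in auto)+
  have cm: "c m \<in> leading_coeffs"
    using nil sum by (auto simp: leading_coeffs_def)
  obtain s where [simp]: "s \<in> carrier R" and s: "nilpotent R ((\<one> \<ominus> c m \<otimes> s) \<otimes> c m)"
    using regular_modulo_nilpotents[of "c m"] by auto
  define w where "w = \<one> \<ominus> c m \<otimes> s"
  have [simp]: "w \<in> carrier R" by (simp add: w_def)
  \<comment> \<open>The leading term after multiplication by \<open>w\<close>.\<close>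
  define n where "n = (w \<otimes> c m) \<odot>\<^bsub>A\<^esub> (a [^]\<^bsub>A\<^esub> m)"
  have [simp]: "n \<in> carrier A" and n: "n \<in> power_span UNIV"
    by (simp_all add: n_def power_span_term)
  have "nilpotent A n"
    using s by (auto simp: n_def w_def intro!: nilpotent_smult)
  then have nil_n: "nilpotent A (\<ominus>\<^bsub>A\<^esub> n)"
    using nilpotent_smult[of "\<ominus> \<one>" n] by (simp add: smult_l_minus)
  have total: "n \<oplus>\<^bsub>A\<^esub> w \<odot>\<^bsub>A\<^esub> ?sum c = w \<odot>\<^bsub>A\<^esub> (c m \<odot>\<^bsub>A\<^esub> (a [^]\<^bsub>A\<^esub> m) \<oplus>\<^bsub>A\<^esub> ?sum c)"
    using sum by (simp add: n_def smult_r_distr smult_assoc1)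
  have "nilpotent A (n \<oplus>\<^bsub>A\<^esub> w \<odot>\<^bsub>A\<^esub> ?sum c)"
    unfolding total using nil sum by (intro nilpotent_smult) auto
  then have "nilpotent A (\<ominus>\<^bsub>A\<^esub> n \<oplus>\<^bsub>A\<^esub> (n \<oplus>\<^bsub>A\<^esub> w \<odot>\<^bsub>A\<^esub> ?sum c))"
    using n sum
    by (intro A.nilpotent_add[OF nil_n])
      (auto intro!: power_span_commute[where S = UNIV and T = UNIV]
        power_span_uminus power_span_add power_span_smult)
  then have "nilpotent A (w \<odot>\<^bsub>A\<^esub> ?sum c)"
    using sum by (simp add: A.a_assoc[symmetric] A.l_neg)
  moreover have "w \<odot>\<^bsub>A\<^esub> ?sum c = ?sum (\<lambda>i. w \<otimes> c i)"
    using T by (simp add: finsum_smult_ldistr smult_assoc1 Pi_def)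
  ultimately have IH: "w \<otimes> c i \<in> leading_coeffs" if "i \<in> T" for i
    using psubset.IH[of T "\<lambda>i. w \<otimes> c i" i] that T by auto
  show "c j \<in> leading_coeffs"
  proof (cases "j = m")
    case False
    then have "w \<otimes> c j \<in> leading_coeffs" using IH psubset.prems T by auto
    moreover have "(s \<otimes> c j) \<otimes> c m \<in> leading_coeffs"
      using cm by (intro leading_coeffs_mult) auto
    moreover have "w \<otimes> c j \<oplus> (s \<otimes> c j) \<otimes> c m = c j"
    proof -
      have "w \<otimes> c j \<oplus> (s \<otimes> c j) \<otimes> c m = (w \<oplus> c m \<otimes> s) \<otimes> c j"
        by (simp add: R.l_distr) (simp add: R.m_ac)
      also have "w \<oplus> c m \<otimes> s = \<one>"
        by (simp add: w_def R.minus_eq R.a_assoc R.l_neg)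
      finally show ?thesis by simp
    qed
    ultimately show ?thesis using leading_coeffs_add by metis
  qed (simp add: cm)
qed

text \<open>The cross terms of the product are lower than \<open>a ^ (m * k)\<close> since \<open>\<prec>\<close> is compatible with
  addition of exponents.\<close>

lemma power_of_leading_form:
  assumes x: "x \<in> lower_terms m" and "k > 0"
  shows "\<exists>y \<in> lower_terms (m * k). (a [^]\<^bsub>A\<^esub> m \<oplus>\<^bsub>A\<^esub> x) [^]\<^bsub>A\<^esub> k = a [^]\<^bsub>A\<^esub> (m * k) \<oplus>\<^bsub>A\<^esub> y"
  using \<open>k > 0\<close>
proof (induction k rule: nat_induct_non_zero)
  case 1
  show ?case using x by (intro bexI[of _ x]) auto
next
  case (Suc k)
  then obtain y where y: "y \<in> lower_terms (m * k)"
    and eq: "(a [^]\<^bsub>A\<^esub> m \<oplus>\<^bsub>A\<^esub> x) [^]\<^bsub>A\<^esub> k = a [^]\<^bsub>A\<^esub> (m * k) \<oplus>\<^bsub>A\<^esub> y" by blast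
  let ?z = "a [^]\<^bsub>A\<^esub> (m * k) \<otimes>\<^bsub>A\<^esub> x \<oplus>\<^bsub>A\<^esub> (y \<otimes>\<^bsub>A\<^esub> a [^]\<^bsub>A\<^esub> m \<oplus>\<^bsub>A\<^esub> y \<otimes>\<^bsub>A\<^esub> x)"
  have p: "a [^]\<^bsub>A\<^esub> i \<in> power_span {i}" for i by (simp add: power_span_power)
  have "a [^]\<^bsub>A\<^esub> (m * k) \<otimes>\<^bsub>A\<^esub> x \<in> lower_terms (m * Suc k)"
    by (rule power_span_mult[OF p x]) (auto dest: prec_add_right[of _ m "m * k"] simp: add.commute)
  moreover have "y \<otimes>\<^bsub>A\<^esub> a [^]\<^bsub>A\<^esub> m \<in> lower_terms (m * Suc k)"
    by (rule power_span_mult[OF y p]) (auto dest: prec_add_right[of _ "m * k" m] simp: add.commute)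
  moreover have "y \<otimes>\<^bsub>A\<^esub> x \<in> lower_terms (m * Suc k)"
    by (rule power_span_mult[OF y x]) (auto dest: prec_add[of _ "m * k" _ m] simp: add.commute)
  ultimately have "?z \<in> lower_terms (m * Suc k)" by (intro power_span_add)
  moreover have "(a [^]\<^bsub>A\<^esub> m \<oplus>\<^bsub>A\<^esub> x) [^]\<^bsub>A\<^esub> Suc k = a [^]\<^bsub>A\<^esub> (m * Suc k) \<oplus>\<^bsub>A\<^esub> ?z"
    using x y by (simp add: eq) (simp add: A.l_distr A.r_distr A.a_ac A.nat_pow_mult add.commute)
  ultimately show ?case by blast
qed

text \<open>The hypothesis is a relation in which the coefficient of \<open>a ^ N\<close> is \<open>1\<close>; the conclusion is one
  whose leading coefficient is \<open>1\<close>.\<close>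

theorem power_among_lower_terms:
  assumes "a [^]\<^bsub>A\<^esub> (N::nat) \<in> power_span S" "N \<notin> S"
  shows "\<exists>M::nat. a [^]\<^bsub>A\<^esub> M \<in> lower_terms M"
proof -
  obtain F c where F: "finite F" "F \<subseteq> S" and c: "c \<in> UNIV \<rightarrow> carrier R"
    and eq: "\<ominus>\<^bsub>A\<^esub> (a [^]\<^bsub>A\<^esub> N) = (\<Oplus>\<^bsub>A\<^esub>i\<in>F. c i \<odot>\<^bsub>A\<^esub> (a [^]\<^bsub>A\<^esub> i))"
    using power_span_imp_finsum[OF power_span_uminus[OF assms(1)]] by blast
  have cc [simp]: "c i \<in> carrier R" for i using c by auto
  have N: "N \<notin> F" using F assms by auto
  define d where "d = c(N := \<one>)"
  have [simp]: "d i \<in> carrier R" for i by (simp add: d_def)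
  have "(\<Oplus>\<^bsub>A\<^esub>i\<in>F. d i \<odot>\<^bsub>A\<^esub> (a [^]\<^bsub>A\<^esub> i)) = (\<Oplus>\<^bsub>A\<^esub>i\<in>F. c i \<odot>\<^bsub>A\<^esub> (a [^]\<^bsub>A\<^esub> i))"
    by (rule A.finsum_cong') (use N in \<open>auto simp: d_def\<close>)
  then have "(\<Oplus>\<^bsub>A\<^esub>i\<in>insert N F. d i \<odot>\<^bsub>A\<^esub> (a [^]\<^bsub>A\<^esub> i)) = \<zero>\<^bsub>A\<^esub>"
    using F N by (simp add: A.finsum_insert Pi_def A.r_neg flip: eq) (simp add: d_def A.r_neg)
  then have "nilpotent A (\<Oplus>\<^bsub>A\<^esub>i\<in>insert N F. d i \<odot>\<^bsub>A\<^esub> (a [^]\<^bsub>A\<^esub> i))"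
    by (auto simp: nilpotent_def intro: exI[of _ "1::nat"])
  then have "d N \<in> leading_coeffs"
    by (intro coeffs_of_nilpotent_are_leading[of "insert N F"]) (use F in auto)
  then obtain m x where x: "x \<in> lower_terms m" and nil: "nilpotent A (a [^]\<^bsub>A\<^esub> m \<oplus>\<^bsub>A\<^esub> x)"
    by (auto simp: leading_coeffs_def d_def)
  obtain k :: nat where k: "(a [^]\<^bsub>A\<^esub> m \<oplus>\<^bsub>A\<^esub> x) [^]\<^bsub>A\<^esub> k = \<zero>\<^bsub>A\<^esub>"
    using nil by (auto simp: nilpotent_def)
  then have "(a [^]\<^bsub>A\<^esub> m \<oplus>\<^bsub>A\<^esub> x) [^]\<^bsub>A\<^esub> Suc k = \<zero>\<^bsub>A\<^esub>" using x by simp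
  then obtain y where y: "y \<in> lower_terms (m * Suc k)"
    and "a [^]\<^bsub>A\<^esub> (m * Suc k) \<oplus>\<^bsub>A\<^esub> y = \<zero>\<^bsub>A\<^esub>"
    using power_of_leading_form[OF x, of "Suc k"] by (metis zero_less_Suc)
  then have "a [^]\<^bsub>A\<^esub> (m * Suc k) = \<ominus>\<^bsub>A\<^esub> y"
    by (intro A.minus_equality[symmetric]) (simp_all add: A.a_comm del: mult_Suc_right)
  with power_span_uminus[OF y] show ?thesis by metis
qed

end

section \<open>Integrality and co-integrality as linear relations between powers\<close>

context algebra_element
begin

lemma adjoin_eq_power_span: "adjoin R A a = power_span UNIV"
proof
  have "subring (power_span UNIV) A"
    using power_span_power[of 0 UNIV]
    by (intro A.subringI)
      (auto intro: power_span_uminus power_span_add power_span_mult)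
  then have "is_subalgebra (power_span UNIV) R A"
    by (auto simp: is_subalgebra_def intro: power_span_smult)
  then show "adjoin R A a \<subseteq> power_span UNIV"
    using power_span_power[of 1 UNIV] by (auto simp: adjoin_def)
next
  have "x \<in> B" if B: "is_subalgebra B R A" "a \<in> B" and "x \<in> power_span UNIV" for B x
    using that(3)
  proof (induction rule: power_span.induct)
    case zero
    show ?case using B subringE(2) by (auto simp: is_subalgebra_def)
  next
    case (add_term r i x)
    have B': "subring B A" using B by (simp add: is_subalgebra_def)
    have "a [^]\<^bsub>A\<^esub> i \<in> B"
      by (induction i) (use B subringE(3,6)[OF B'] in auto)
    then show ?case using add_term B subringE(7)[OF B'] by (auto simp: is_subalgebra_def)
  qed
  then show "power_span UNIV \<subseteq> adjoin R A a" by (auto simp: adjoin_def)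
qed

lemma power_span_factor:
  assumes "x \<in> power_span {n..}"
  shows "\<exists>y \<in> power_span UNIV. x = a [^]\<^bsub>A\<^esub> n \<otimes>\<^bsub>A\<^esub> y"
  using assms
proof (induction rule: power_span.induct)
  case zero
  show ?case by (rule bexI[of _ "\<zero>\<^bsub>A\<^esub>"]) (auto simp: power_span.zero)
next
  case (add_term r i x)
  then obtain y where y: "y \<in> power_span UNIV" "x = a [^]\<^bsub>A\<^esub> n \<otimes>\<^bsub>A\<^esub> y" by blast
  have "r \<odot>\<^bsub>A\<^esub> (a [^]\<^bsub>A\<^esub> i) \<oplus>\<^bsub>A\<^esub> x
      = a [^]\<^bsub>A\<^esub> n \<otimes>\<^bsub>A\<^esub> (r \<odot>\<^bsub>A\<^esub> (a [^]\<^bsub>A\<^esub> (i - n)) \<oplus>\<^bsub>A\<^esub> y)"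
    using y add_term by (simp add: A.r_distr smult_mult_right A.nat_pow_mult)
  moreover have "r \<odot>\<^bsub>A\<^esub> (a [^]\<^bsub>A\<^esub> (i - n)) \<oplus>\<^bsub>A\<^esub> y \<in> power_span UNIV"
    using y add_term by (intro power_span.add_term) auto
  ultimately show ?case by blast
qed

text \<open>The inclusion of \<open>a ^ (N + 1) R[a]\<close> in \<open>a ^ N R[a]\<close> always holds, and the reverse one holds
  as soon as \<open>a ^ N\<close> belongs to \<open>a ^ (N + 1) R[a]\<close>, the span of the powers beyond \<open>N\<close>.\<close>

lemma cointegral_iff: "cointegral_over R A a \<longleftrightarrow> (\<exists>N::nat. a [^]\<^bsub>A\<^esub> N \<in> power_span {N<..})"
proof -
  have "a [^]\<^bsub>A\<^esub> N <#\<^bsub>A\<^esub> power_span UNIV = a [^]\<^bsub>A\<^esub> (N + 1) <#\<^bsub>A\<^esub> power_span UNIV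
      \<longleftrightarrow> a [^]\<^bsub>A\<^esub> N \<in> power_span {N<..}" (is "?coset N = ?coset (N + 1) \<longleftrightarrow> _") for N :: nat
  proof
    assume "?coset N = ?coset (N + 1)"
    moreover have "a [^]\<^bsub>A\<^esub> N \<otimes>\<^bsub>A\<^esub> \<one>\<^bsub>A\<^esub> \<in> ?coset N"
      using power_span_power[of 0 UNIV] by (force simp: l_coset_def)
    ultimately obtain y where "y \<in> power_span UNIV"
      and "a [^]\<^bsub>A\<^esub> N = a [^]\<^bsub>A\<^esub> (N + 1) \<otimes>\<^bsub>A\<^esub> y"
      by (auto simp: l_coset_def)
    then show "a [^]\<^bsub>A\<^esub> N \<in> power_span {N<..}"
      using power_span_mult[OF power_span_power[of "N + 1" "{N + 1}"], of y UNIV "{N<..}"] by auto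
  next
    assume "a [^]\<^bsub>A\<^esub> N \<in> power_span {N<..}"
    then obtain y where y: "y \<in> power_span UNIV"
      and eq: "a [^]\<^bsub>A\<^esub> N = a [^]\<^bsub>A\<^esub> (N + 1) \<otimes>\<^bsub>A\<^esub> y"
      using power_span_factor[of _ "N + 1"] by (auto simp: atLeast_Suc_greaterThan)
    have "a [^]\<^bsub>A\<^esub> N \<otimes>\<^bsub>A\<^esub> z \<in> ?coset (N + 1)" if z: "z \<in> power_span UNIV" for z
    proof -
      have "a [^]\<^bsub>A\<^esub> N \<otimes>\<^bsub>A\<^esub> z = a [^]\<^bsub>A\<^esub> (N + 1) \<otimes>\<^bsub>A\<^esub> (y \<otimes>\<^bsub>A\<^esub> z)"
        using y z by (subst eq) (simp add: A.m_assoc)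
      moreover have "y \<otimes>\<^bsub>A\<^esub> z \<in> power_span UNIV" by (rule power_span_mult[OF y z]) auto
      ultimately show ?thesis unfolding l_coset_def by blast
    qed
    moreover have "a [^]\<^bsub>A\<^esub> (N + 1) \<otimes>\<^bsub>A\<^esub> z \<in> ?coset N" if z: "z \<in> power_span UNIV" for z
    proof -
      have "a [^]\<^bsub>A\<^esub> (N + 1) \<otimes>\<^bsub>A\<^esub> z = a [^]\<^bsub>A\<^esub> N \<otimes>\<^bsub>A\<^esub> (a \<otimes>\<^bsub>A\<^esub> z)"
        using z by (simp add: A.m_assoc)
      moreover have "a \<otimes>\<^bsub>A\<^esub> z \<in> power_span UNIV"
        using power_span_mult[OF power_span_power[of 1 UNIV] z, of UNIV] by simp
      ultimately show ?thesis unfolding l_coset_def by blast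
    qed
    ultimately show "?coset N = ?coset (N + 1)" unfolding l_coset_def by blast
  qed
  then show ?thesis by (simp add: cointegral_over_def adjoin_eq_power_span)
qed

lemma eval_structure_map:
  assumes "f \<in> carrier (UP R)"
  shows "eval R A (structure_map R A) a f
    = (\<Oplus>\<^bsub>A\<^esub>i\<in>{..deg R f}. coeff (UP R) f i \<odot>\<^bsub>A\<^esub> (a [^]\<^bsub>A\<^esub> i))"
proof -
  interpret UP_cring R "UP R" by unfold_locales simp
  have "coeff (UP R) f i \<in> carrier R" for i using assms by (rule coeff_closed)
  then show ?thesis
    using assms by (auto simp: eval_def structure_map_def smult_mult_left intro!: A.finsum_cong')
qed

text \<open>A monic polynomial of degree \<open>N\<close> that vanishes at \<open>a\<close> expresses \<open>a ^ N\<close> by smaller powers, and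
  conversely. Over the zero ring, where the degree of every polynomial is \<open>0\<close>, the constructed
  polynomial is monic because \<open>\<one> = \<zero>\<close>, and its value vanishes because \<open>A\<close> is zero too.\<close>

lemma integral_iff: "integral_over R A a \<longleftrightarrow> (\<exists>N::nat. a [^]\<^bsub>A\<^esub> N \<in> power_span {..<N})"
proof -
  interpret P: UP_cring R "UP R" by unfold_locales simp
  show ?thesis
  proof
    assume "integral_over R A a"
    then obtain f where f: "f \<in> carrier (UP R)" and lead: "coeff (UP R) f (deg R f) = \<one>"
      and ev: "eval R A (structure_map R A) a f = \<zero>\<^bsub>A\<^esub>"
      by (auto simp: integral_over_def monic_def)
    have cc [simp]: "coeff (UP R) f i \<in> carrier R" for i using f by (rule P.coeff_closed)
    let ?N = "deg R f"
    let ?s = "\<Oplus>\<^bsub>A\<^esub>i\<in>{..<?N}. coeff (UP R) f i \<odot>\<^bsub>A\<^esub> (a [^]\<^bsub>A\<^esub> i)"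
    have s: "?s \<in> power_span {..<?N}" by (rule finsum_in_power_span) auto
    have "a [^]\<^bsub>A\<^esub> ?N \<oplus>\<^bsub>A\<^esub> ?s = \<zero>\<^bsub>A\<^esub>"
      using ev by (simp add: eval_structure_map[OF f]
          lessThan_Suc_atMost[symmetric] lessThan_Suc A.finsum_insert Pi_def lead)
    then have "a [^]\<^bsub>A\<^esub> ?N = \<ominus>\<^bsub>A\<^esub> ?s"
      using s by (intro A.minus_equality[symmetric]) (simp_all add: A.a_comm)
    with power_span_uminus[OF s] show "\<exists>N::nat. a [^]\<^bsub>A\<^esub> N \<in> power_span {..<N}" by metis
  next
    assume "\<exists>N::nat. a [^]\<^bsub>A\<^esub> N \<in> power_span {..<N}"
    then obtain N :: nat where "a [^]\<^bsub>A\<^esub> N \<in> power_span {..<N}" by blast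
    from power_span_imp_finsum[OF power_span_uminus[OF this]]
    obtain F c where F: "finite F" "F \<subseteq> {..<N}" and c: "c \<in> UNIV \<rightarrow> carrier R"
      and eq: "\<ominus>\<^bsub>A\<^esub> (a [^]\<^bsub>A\<^esub> N) = (\<Oplus>\<^bsub>A\<^esub>i\<in>F. c i \<odot>\<^bsub>A\<^esub> (a [^]\<^bsub>A\<^esub> i))" by blast
    have [simp]: "c i \<in> carrier R" for i using c by auto
    define f where "f i = (if i = N then \<one> else if i \<in> F then c i else \<zero>)" for i
    have [simp]: "f i \<in> carrier R" for i by (simp add: f_def)
    have bound: "f i = \<zero>" if "N < i" for i using F that by (auto simp: f_def)
    have up: "f \<in> up R" using bound by (intro mem_upI) (auto simp: bound_def)
    then have f: "f \<in> carrier (UP R)" by (simp add: UP_def)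
    have coeff: "coeff (UP R) f i = f i" for i using up by (simp add: UP_def)
    have "monic R f \<and> eval R A (structure_map R A) a f = \<zero>\<^bsub>A\<^esub>"
    proof (cases "\<one> = \<zero>")
      case True
      then have triv: "r = \<zero>" if "r \<in> carrier R" for r using that R.l_one R.l_null by metis
      have trivA: "x = \<zero>\<^bsub>A\<^esub>" if "x \<in> carrier A" for x
        using that True smult_one smult_l_null by metis
      show ?thesis
        using f True triv[of "f (deg R f)"]
        by (auto simp: monic_def coeff eval_structure_map intro!: trivA A.finsum_closed)
    next
      case False
      have deg: "deg R f = N"
        by (intro antisym P.deg_aboveI P.deg_belowI) (use f False bound in \<open>simp_all add: coeff, simp add: f_def\<close>)
      have "(\<Oplus>\<^bsub>A\<^esub>i\<in>F. c i \<odot>\<^bsub>A\<^esub> (a [^]\<^bsub>A\<^esub> i)) = (\<Oplus>\<^bsub>A\<^esub>i\<in>{..<N}. f i \<odot>\<^bsub>A\<^esub> (a [^]\<^bsub>A\<^esub> i))"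
        by (rule A.add.finprod_mono_neutral_cong_left) (use F in \<open>auto simp: f_def\<close>)
      then have "(\<Oplus>\<^bsub>A\<^esub>i\<in>{..N}. f i \<odot>\<^bsub>A\<^esub> (a [^]\<^bsub>A\<^esub> i)) = f N \<odot>\<^bsub>A\<^esub> (a [^]\<^bsub>A\<^esub> N) \<oplus>\<^bsub>A\<^esub> \<ominus>\<^bsub>A\<^esub> (a [^]\<^bsub>A\<^esub> N)"
        by (simp add: eq lessThan_Suc_atMost[symmetric] lessThan_Suc A.finsum_insert Pi_def)
      also have "\<dots> = \<zero>\<^bsub>A\<^esub>" by (simp add: f_def A.r_neg)
      finally show ?thesis
        using f by (simp add: monic_def eval_structure_map deg coeff) (simp add: f_def)
    qed
    then show "integral_over R A a" by (auto simp: integral_over_def)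
  qed
qed

end

theorem theorem2p2:
  fixes R :: "('r, 'm) ring_scheme" and A :: "('r, 'a, 'n) module_scheme" and a :: 'a
  assumes "artinian_cring R"
    and "assoc_algebra R A"
    and "a \<in> carrier A"
  shows "cointegral_over R A a \<longleftrightarrow> integral_over R A a"
proof -
  interpret R: artinian_cring R by fact
  interpret assoc_algebra R A by fact
  interpret algebra_element R A a by unfold_locales fact
  interpret lowest: leading_terms R A a "(>)" by unfold_locales auto
  interpret highest: leading_terms R A a "(<)" by unfold_locales auto
  show ?thesis
    unfolding cointegral_iff integral_iff
    using lowest.power_among_lower_terms highest.power_among_lower_terms
    by (fastforce simp: lessThan_def greaterThan_def)
qed

end
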